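(* Let $G$ and $H$ be any binary games. Then $G \geqslant^-_{\mathcal{DB}} H$ if and only if $G \geqslant^-_{\mathcal{D}} H$.
   Context: A game is a finite two-player combinatorial game, defined recursively by $G=\{G^{\mathbf L}\mid G^{\mathbf R}\}$, where $G^{\mathbf L}$ and $G^{\mathbf R}$ are the finite sets of Left options and Right options, which are themselves games. The game $0=\{\cdot\mid\cdot\}$ has no options. The sum is $G+H=\{G^{\mathbf L}+H,\,G+H^{\mathbf L}\mid G^{\mathbf R}+H,\,G+H^{\mathbf R}\}$. Left and Right alternate moves. Under misère play, a player who cannot move on their turn wins. The misère outcome $o^-(G)$ is $\mathcal L$ (Left wins whoever starts), $\mathcal R$ (Right wins whoever starts), $\mathcal N$ (the first player wins) or $\mathcal P$ (the second player wins). Outcomes are partially ordered by $\mathcal R<\mathcal N<\mathcal L$ and $\mathcal R<\mathcal P<\mathcal L$, with $\mathcal N$ and $\mathcal P$ incomparable. For a set $\mathcal U$ of games and games $G,H$ (not necessarily in $\mathcal U$), $G\geqslant^-_{\mathcal U}H$ means $o^-(G+X)\geqslant o^-(H+X)$ for every $X\in\mathcal U$. A game is dicot if it is $0$, or if it has both Left and Right options and all of them are dicot. A game is binary if it has at most one Left option and at most one Right option, and all these options, if any, are binary. $\mathcal D$ is the set of all dicot games and $\mathcal{DB}$ is the set of all games that are both binary and dicot. *)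

theory Defs
  imports "HOL-Library.FSet"
begin

datatype game = Game (left_opts: "game fset") (right_opts: "game fset")

datatype player = Left | Right

fun opponent :: "player \<Rightarrow> player" where
  "opponent Left = Right"
| "opponent Right = Left"

fun opts :: "player \<Rightarrow> game \<Rightarrow> game fset" where
  "opts Left G = left_opts G"
| "opts Right G = right_opts G"

lemma size_left_option:
  assumes "H |\<in>| left_opts G"
  shows "size H < size G"
proof -
  have "Suc (size H) \<le> (\<Sum>x\<in>fset (left_opts G). Suc (size x))"
    using assms by (intro member_le_sum) auto
  then show ?thesis by (cases G) simp
qed

lemma size_right_option:
  assumes "H |\<in>| right_opts G"
  shows "size H < size G"
proof -
  have "Suc (size H) \<le> (\<Sum>x\<in>fset (right_opts G). Suc (size x))"
    using assms by (intro member_le_sum) auto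
  then show ?thesis by (cases G) simp
qed

lemma size_option: "H |\<in>| opts p G \<Longrightarrow> size H < size G"
  by (cases p) (auto simp: size_left_option size_right_option)

lemmas [fundef_cong] = fimage_cong

instantiation game :: "{zero, plus}"
begin

definition zero_game :: game where
  "0 = Game {||} {||}"

function plus_game :: "game \<Rightarrow> game \<Rightarrow> game" where
  "G + H = Game
     ((\<lambda>G'. G' + H) |`| left_opts G |\<union>| (\<lambda>H'. G + H') |`| left_opts H)
     ((\<lambda>G'. G' + H) |`| right_opts G |\<union>| (\<lambda>H'. G + H') |`| right_opts H)"
  by pat_completeness auto
termination
  by (relation "measure (\<lambda>(G, H). size G + size H)")
     (auto simp: size_left_option size_right_option)

instance ..

end

declare plus_game.simps [simp del]

text \<open>\<open>wins_first p G\<close>: player \<open>p\<close>, to move in \<open>G\<close>, has a winning strategy under misere play.\<close>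
function wins_first :: "player \<Rightarrow> game \<Rightarrow> bool" where
  "wins_first p G \<longleftrightarrow>
     opts p G = {||} \<or> (\<exists>G' |\<in>| opts p G. \<not> wins_first (opponent p) G')"
  by pat_completeness auto
termination
  by (relation "measure (\<lambda>(p, G). size G)") (auto simp: size_option)

declare wins_first.simps [simp del]

datatype outcome = Left_Wins | Right_Wins | First_Wins | Second_Wins

instantiation outcome :: order
begin

definition less_eq_outcome :: "outcome \<Rightarrow> outcome \<Rightarrow> bool" where
  "x \<le> y \<longleftrightarrow> x = y \<or> x = Right_Wins \<or> y = Left_Wins"

definition less_outcome :: "outcome \<Rightarrow> outcome \<Rightarrow> bool" where
  "(x :: outcome) < y \<longleftrightarrow> x \<le> y \<and> x \<noteq> y"

instance
  by standard (auto simp: less_eq_outcome_def less_outcome_def)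

end

text \<open>A play cannot be drawn, so a player who does not win moving first loses to the opponent
  moving second.\<close>
definition misere_outcome :: "game \<Rightarrow> outcome" where
  "misere_outcome G =
     (if wins_first Left G
      then (if wins_first Right G then First_Wins else Left_Wins)
      else (if wins_first Right G then Right_Wins else Second_Wins))"

definition misere_ge :: "game set \<Rightarrow> game \<Rightarrow> game \<Rightarrow> bool" where
  "misere_ge U G H \<longleftrightarrow> (\<forall>X\<in>U. misere_outcome (G + X) \<ge> misere_outcome (H + X))"

inductive dicot :: "game \<Rightarrow> bool" where
  dicot_zero: "dicot 0"
| dicot_step:
    "\<lbrakk>left_opts G \<noteq> {||}; right_opts G \<noteq> {||};
      \<And>H. H |\<in>| left_opts G \<Longrightarrow> dicot H;
      \<And>H. H |\<in>| right_opts G \<Longrightarrow> dicot H\<rbrakk> \<Longrightarrow> dicot G"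

inductive binary :: "game \<Rightarrow> bool" where
  "\<lbrakk>fcard (left_opts G) \<le> 1; fcard (right_opts G) \<le> 1;
    \<And>H. H |\<in>| left_opts G \<Longrightarrow> binary H;
    \<And>H. H |\<in>| right_opts G \<Longrightarrow> binary H\<rbrakk> \<Longrightarrow> binary G"

definition dicot_games :: "game set" where
  "dicot_games = {G. dicot G}"

definition binary_dicot_games :: "game set" where
  "binary_dicot_games = {G. binary G \<and> dicot G}"

end

(* Both relations satisfy the same recursive test.  If G >= H over the binary dicot games, then
   every Right option G^R of G satisfies G^R >= H^R for some H^R or G^RL >= H for some G^RL, and
   dually for the Left options of H: otherwise a game {Z | Y}, with Z separating G^R from H^R and
   Y separating G^RL from H, would separate G from H.  Since G and H are binary there is at most
   one H^R and at most one G^RL, so one Left option and one Right option suffice and {Z | Y} is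
   again binary.  Conversely, the test together with the outcomes of G and H themselves (X = 0)
   yields G >= H over all dicot games by induction. *)
theory Submission
  imports Defs
begin

section \<open>Options of sums, binary games and dicot games\<close>

lemma opponent_opponent [simp]: "opponent (opponent p) = p"
  by (cases p) auto

text \<open>Naming the options by \<open>p\<close> and the opponent, not by Left and Right, lets
  each construction below serve both players.\<close>

fun player_game :: "player \<Rightarrow> game fset \<Rightarrow> game fset \<Rightarrow> game" where
  "player_game Left A B = Game A B"
| "player_game Right A B = Game B A"

lemma opts_player_game [simp]:
  "opts p (player_game p A B) = A"
  "opts (opponent p) (player_game p A B) = B"
  by (cases p; simp)+

lemma opts_plus:
  "opts p (G + H) = (\<lambda>G'. G' + H) |`| opts p G |\<union>| (\<lambda>H'. G + H') |`| opts p H"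
  by (cases p) (subst plus_game.simps, simp)+

lemma binary_option: "binary G \<Longrightarrow> G' |\<in>| opts p G \<Longrightarrow> binary G'"
  by (erule binary.cases) (cases p; simp)

lemma fcard_le_1_unique: "fcard A \<le> 1 \<Longrightarrow> x |\<in>| A \<Longrightarrow> y |\<in>| A \<Longrightarrow> x = y"
  by (metis One_nat_def card_le_Suc0_iff_eq fcard.rep_eq finite_fset)

lemma binary_option_unique:
  "binary G \<Longrightarrow> G' |\<in>| opts p G \<Longrightarrow> G'' |\<in>| opts p G \<Longrightarrow> G' = G''"
  by (erule binary.cases) (cases p; simp add: fcard_le_1_unique)

lemma binary_opts_cases:
  assumes "binary G"
  obtains "opts p G = {||}" | G' where "opts p G = {|G'|}" "binary G'"
proof (cases "opts p G = {||}")
  case False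
  then obtain G' where G': "G' |\<in>| opts p G"
    by auto
  moreover have "opts p G = {|G'|}"
    using G' binary_option_unique[OF assms] by (intro fset_eqI) auto
  ultimately show ?thesis
    using that(2) binary_option[OF assms] by blast
qed (use that in blast)

lemma dicot_option: "dicot X \<Longrightarrow> X' |\<in>| opts p X \<Longrightarrow> dicot X'"
  by (erule dicot.cases) (cases p; auto simp: zero_game_def)+

lemma dicot_opts_nonempty: "dicot X \<Longrightarrow> X \<noteq> 0 \<Longrightarrow> opts p X \<noteq> {||}"
  by (erule dicot.cases) (cases p; simp)+

lemma zero_mem_binary_dicot: "0 \<in> binary_dicot_games"
proof -
  have "binary 0"
    by (rule binary.intros) (auto simp: zero_game_def fcard.rep_eq)
  then show ?thesis
    by (simp add: binary_dicot_games_def dicot_zero)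
qed

lemma player_game_mem_binary_dicot:
  assumes "A \<in> binary_dicot_games" "B \<in> binary_dicot_games"
  shows "player_game p {|A|} {|B|} \<in> binary_dicot_games"
proof -
  have "fcard {|x|} \<le> 1" for x :: game
    by (simp add: fcard.rep_eq)
  moreover have "binary A" "binary B" "dicot A" "dicot B"
    using assms by (auto simp: binary_dicot_games_def)
  ultimately have "binary (Game {|A|} {|B|})" "dicot (Game {|A|} {|B|})"
    "binary (Game {|B|} {|A|})" "dicot (Game {|B|} {|A|})"
    by (auto intro: binary.intros[of "Game {|A|} {|B|}"] binary.intros[of "Game {|B|} {|A|}"]
        dicot_step[of "Game {|A|} {|B|}"] dicot_step[of "Game {|B|} {|A|}"])
  then show ?thesis
    by (cases p) (simp_all add: binary_dicot_games_def)
qed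

text \<open>An available move in \<open>X\<close> excludes the misere win by being unable to move,
  so a win must come from a move in one component.\<close>

lemma wins_first_plus:
  assumes "opts p X \<noteq> {||}"
  shows "wins_first p (G + X) \<longleftrightarrow>
    (\<exists>G'|\<in>|opts p G. \<not> wins_first (opponent p) (G' + X)) \<or>
    (\<exists>X'|\<in>|opts p X. \<not> wins_first (opponent p) (G + X'))"
  using assms by (subst wins_first.simps) (auto simp: opts_plus)

lemma wins_first_plus_player_game:
  "wins_first p (G + player_game p {|A|} B) \<longleftrightarrow>
    \<not> wins_first (opponent p) (G + A) \<or>
    (\<exists>G'|\<in>|opts p G. \<not> wins_first (opponent p) (G' + player_game p {|A|} B))"
  by (subst wins_first_plus) auto

lemma wins_first_opponent_plus_player_game:
  "wins_first (opponent p) (G + player_game p A {|B|}) \<longleftrightarrow>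
    \<not> wins_first p (G + B) \<or>
    (\<exists>G'|\<in>|opts (opponent p) G. \<not> wins_first p (G' + player_game p A {|B|}))"
  by (subst wins_first_plus) auto

text \<open>The outcome order split by who starts, seen from the side of \<open>p\<close>.
  Exchanging the players amounts to exchanging \<open>G\<close> and \<open>H\<close>, so every dual
  statement comes for free.\<close>

definition prefers :: "player \<Rightarrow> game set \<Rightarrow> game \<Rightarrow> game \<Rightarrow> bool" where
  "prefers p U G H \<longleftrightarrow> (\<forall>X\<in>U.
     (wins_first p (H + X) \<longrightarrow> wins_first p (G + X)) \<and>
     (wins_first (opponent p) (G + X) \<longrightarrow> wins_first (opponent p) (H + X)))"

lemma misere_ge_iff_prefers: "misere_ge U G H \<longleftrightarrow> prefers Left U G H"
  unfolding misere_ge_def prefers_def misere_outcome_def less_eq_outcome_def by auto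

lemma prefers_opponent: "prefers (opponent p) U G H \<longleftrightarrow> prefers p U H G"
  unfolding prefers_def by auto

(* With p in the role of Right, W(K) = {W(K^R) | W(K^L)}: the second player answers each move in the
   other component, reaching a pair K' + W(K').  A missing option of K is replaced by 0. *)
lemma exists_binary_dicot_loses_first:
  assumes "binary K"
  shows "\<exists>W\<in>binary_dicot_games. \<not> wins_first p (K + W)"
  using assms
proof (induction "size K" arbitrary: K rule: less_induct)
  case less
  have ans: "\<exists>W\<in>binary_dicot_games. \<forall>K'|\<in>|opts q K. \<not> wins_first p (K' + W)" for q
    using less.prems
  proof (cases rule: binary_opts_cases[where p = q])
    case 1
    then show ?thesis using zero_mem_binary_dicot by auto
  next
    case (2 K')
    then show ?thesis using less.hyps[of K'] size_option[of K' q K] by auto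
  qed
  obtain A where A: "A \<in> binary_dicot_games"
      "\<forall>K'|\<in>|opts (opponent p) K. \<not> wins_first p (K' + A)"
      "opts (opponent p) K = {||} \<Longrightarrow> A = 0"
    using ans[of "opponent p"] zero_mem_binary_dicot
    by (cases "opts (opponent p) K = {||}") auto
  obtain B where B: "B \<in> binary_dicot_games"
      "\<forall>K'|\<in>|opts p K. \<not> wins_first p (K' + B)"
    using ans[of p] by blast
  \<comment> \<open>The move of \<open>p\<close> to \<open>A\<close> is answered inside
    \<open>K\<close>. If the opponent has no option there, \<open>A = 0\<close> leaves the opponent
    without any move, which wins.\<close>
  have "wins_first (opponent p) (K + A)"
  proof (cases "opts (opponent p) K = {||}")
    case True
    then have "opts (opponent p) (K + A) = {||}"
      using A(3) by (cases p) (auto simp: opts_plus zero_game_def)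
    then show ?thesis by (subst wins_first.simps) auto
  next
    case False
    then show ?thesis
      using A(2) by (subst wins_first.simps) (auto simp: opts_plus)
  qed
  moreover have "wins_first (opponent p) (K' + player_game p {|A|} {|B|})"
    if "K' |\<in>| opts p K" for K'
    using B(2) that by (subst wins_first_opponent_plus_player_game) auto
  ultimately have "\<not> wins_first p (K + player_game p {|A|} {|B|})"
    by (subst wins_first_plus_player_game) auto
  then show ?case
    using player_game_mem_binary_dicot A(1) B(1) by blast
qed

text \<open>Moving to a \<open>W\<close> on which the opponent loses when starting is a winning
  first move. The second copy of \<open>W\<close> only keeps the game dicot.\<close>

lemma exists_binary_dicot_wins_first:
  assumes "binary K"
  shows "\<exists>W\<in>binary_dicot_games. wins_first p (K + W)"
proof -
  obtain W where W: "W \<in> binary_dicot_games" "\<not> wins_first (opponent p) (K + W)"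
    using exists_binary_dicot_loses_first[OF assms] by blast
  then have "wins_first p (K + player_game p {|W|} {|W|})"
    by (subst wins_first_plus_player_game) auto
  then show ?thesis
    using player_game_mem_binary_dicot W(1) by blast
qed

section \<open>Separating games and the recursive test\<close>

text \<open>A separating \<open>Z\<close> for the opponent starting becomes one for \<open>p\<close>
  starting: \<open>p\<close> moves to \<open>Z\<close>, and the opponent's option \<open>W\<close>
  refutes any move of \<open>p\<close> in \<open>G\<close> instead.\<close>

lemma not_prefers_imp_separated_first:
  assumes "\<not> prefers p binary_dicot_games G H" "binary G"
  shows "\<exists>Y\<in>binary_dicot_games. wins_first p (H + Y) \<and> \<not> wins_first p (G + Y)"
proof (rule ccontr)
  assume contra: "\<not> ?thesis"
  then obtain Z where Z: "Z \<in> binary_dicot_games"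
      "wins_first (opponent p) (G + Z)" "\<not> wins_first (opponent p) (H + Z)"
    using assms(1) unfolding prefers_def by blast
  obtain W where W: "W \<in> binary_dicot_games" "\<forall>G'|\<in>|opts p G. \<not> wins_first p (G' + W)"
    using assms(2)
  proof (cases rule: binary_opts_cases[where p = p])
    case 1
    then show ?thesis using that zero_mem_binary_dicot by auto
  next
    case (2 G')
    then show ?thesis using that exists_binary_dicot_loses_first[of G'] by auto
  qed
  let ?Y = "player_game p {|Z|} {|W|}"
  have "wins_first p (H + ?Y)"
    using Z(3) by (subst wins_first_plus_player_game) auto
  moreover have "wins_first (opponent p) (G' + ?Y)" if "G' |\<in>| opts p G" for G'
    using W(2) that by (subst wins_first_opponent_plus_player_game) auto
  then have "\<not> wins_first p (G + ?Y)"
    using Z(2) by (subst wins_first_plus_player_game) auto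
  ultimately show False
    using contra player_game_mem_binary_dicot Z(1) W(1) by blast
qed

lemma not_prefers_imp_separated_second:
  assumes "\<not> prefers p binary_dicot_games G H" "binary H"
  shows "\<exists>Z\<in>binary_dicot_games.
    wins_first (opponent p) (G + Z) \<and> \<not> wins_first (opponent p) (H + Z)"
  using not_prefers_imp_separated_first[of "opponent p" H G, unfolded prefers_opponent, OF assms]
  by blast

lemma prefers_opponent_option:
  assumes "prefers p binary_dicot_games G H" "binary G" "binary H"
    and G': "G' |\<in>| opts (opponent p) G"
  shows "(\<exists>H'|\<in>|opts (opponent p) H. prefers p binary_dicot_games G' H') \<or>
    (\<exists>G''|\<in>|opts p G'. prefers p binary_dicot_games G'' H)"
proof (rule ccontr)
  assume contra: "\<not> ?thesis"
  have bin_G': "binary G'"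
    using assms(2) G' by (rule binary_option)
  \<comment> \<open>If \<open>H\<close> has no option to be separated from, any \<open>Z\<close> on
    which the opponent wins \<open>G' + Z\<close> will do; likewise for \<open>Y\<close>
    below.\<close>
  obtain Z where Z: "Z \<in> binary_dicot_games" "wins_first (opponent p) (G' + Z)"
      "\<forall>H'|\<in>|opts (opponent p) H. \<not> wins_first (opponent p) (H' + Z)"
    using assms(3)
  proof (cases rule: binary_opts_cases[where p = "opponent p"])
    case 1
    then show ?thesis using that exists_binary_dicot_wins_first[OF bin_G'] by auto
  next
    case (2 H')
    then have "\<not> prefers p binary_dicot_games G' H'"
      using contra by blast
    with 2 show ?thesis
      using that not_prefers_imp_separated_second[of p G' H'] by auto
  qed
  obtain Y where Y: "Y \<in> binary_dicot_games" "wins_first p (H + Y)"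
      "\<forall>G''|\<in>|opts p G'. \<not> wins_first p (G'' + Y)"
    using bin_G'
  proof (cases rule: binary_opts_cases[where p = p])
    case 1
    then show ?thesis using that exists_binary_dicot_wins_first[OF assms(3)] by auto
  next
    case (2 G'')
    then have "\<not> prefers p binary_dicot_games G'' H"
      using contra by blast
    with 2 show ?thesis
      using that not_prefers_imp_separated_first[of p G'' H] by auto
  qed
  \<comment> \<open>Let the opponent start. In \<open>G + ?X\<close> the move to \<open>G'\<close>
    wins: \<open>Z\<close> then loses for \<open>p\<close>, and each \<open>G''\<close> is answered
    by \<open>Y\<close>. In \<open>H + ?X\<close> every move fails: \<open>Y\<close> leaves
    \<open>p\<close> a win, and each \<open>H'\<close> is answered by \<open>Z\<close>.\<close>
  let ?X = "player_game p {|Z|} {|Y|}"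
  have "wins_first (opponent p) (G'' + ?X)" if "G'' |\<in>| opts p G'" for G''
    using Y(3) that by (subst wins_first_opponent_plus_player_game) auto
  then have "\<not> wins_first p (G' + ?X)"
    using Z(2) by (subst wins_first_plus_player_game) auto
  then have "wins_first (opponent p) (G + ?X)"
    using G' by (subst wins_first_opponent_plus_player_game) auto
  moreover have "wins_first p (H' + ?X)" if "H' |\<in>| opts (opponent p) H" for H'
    using Z(3) that by (subst wins_first_plus_player_game) auto
  then have "\<not> wins_first (opponent p) (H + ?X)"
    using Y(2) by (subst wins_first_opponent_plus_player_game) auto
  ultimately show False
    using assms(1) player_game_mem_binary_dicot Z(1) Y(1) unfolding prefers_def by blast
qed

lemma prefers_option:
  assumes "prefers p binary_dicot_games G H" "binary G" "binary H"
    and "H' |\<in>| opts p H"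
  shows "(\<exists>G'|\<in>|opts p G. prefers p binary_dicot_games G' H') \<or>
    (\<exists>H''|\<in>|opts (opponent p) H'. prefers p binary_dicot_games G H'')"
  using prefers_opponent_option[of "opponent p" H G H', unfolded prefers_opponent opponent_opponent,
      OF assms(1,3,2,4)] .

section \<open>From binary dicot to dicot games\<close>

lemma prefers_binary_dicot_wins_first:
  assumes "prefers p binary_dicot_games G H" "binary G" "binary H" "dicot X"
    and "wins_first p (H + X)"
  shows "wins_first p (G + X)"
  using assms
proof (induction "size G + size H + size X" arbitrary: p G H X rule: less_induct)
  case less
  note pref = less.prems(1) and bin = less.prems(2,3) and dicot = less.prems(4)
  show ?case
  \<comment> \<open>Only \<open>0\<close> lacks moves among dicot games, and it is itself a binary
    dicot game, so the hypothesis settles it directly.\<close>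
  proof (cases "X = 0")
    case True
    then show ?thesis
      using pref less.prems(5) zero_mem_binary_dicot unfolding prefers_def by blast
  next
    case False
    note step = wins_first_plus[OF dicot_opts_nonempty[OF dicot False]]
    note step_p = step[of p]
    from less.prems(5)[unfolded step_p] consider
        (X) X' where "X' |\<in>| opts p X" "\<not> wins_first (opponent p) (H + X')"
      | (H) H' where "H' |\<in>| opts p H" "\<not> wins_first (opponent p) (H' + X)"
      by blast
    then show ?thesis
    proof cases
      case X
      \<comment> \<open>The induction hypothesis is used contrapositively, for the opponent and with
        \<open>G\<close> and \<open>H\<close> exchanged.\<close>
      have "\<not> wins_first (opponent p) (G + X')"
        using less.hyps[of H G X' "opponent p"] size_option[OF X(1)] pref bin
          dicot_option[OF dicot X(1)] X(2)
        by (auto simp: prefers_opponent)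
      then show ?thesis using X(1) unfolding step_p by blast
    next
      case H
      have bin_H': "binary H'"
        using bin(2) H(1) by (rule binary_option)
      from prefers_option[OF pref bin H(1)] consider
          (option) G' where "G' |\<in>| opts p G" "prefers p binary_dicot_games G' H'"
        | (reversible) H'' where "H'' |\<in>| opts (opponent p) H'"
            "prefers p binary_dicot_games G H''"
        by blast
      then show ?thesis
      proof cases
        case option
        have "\<not> wins_first (opponent p) (G' + X)"
          using less.hyps[of H' G' X "opponent p"] size_option[OF H(1)]
            size_option[OF option(1)] option(2) bin_H' binary_option[OF bin(1) option(1)]
            dicot H(2)
          by (auto simp: prefers_opponent)
        then show ?thesis using option(1) unfolding step_p by blast
      next
        case reversible
        \<comment> \<open>The move to \<open>H'\<close> wins for \<open>p\<close>, so it also beats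
          the opponent's reply \<open>H''\<close>; hence \<open>H''\<close> can take the place of
          \<open>H\<close>.\<close>
        have "wins_first p (H'' + X)"
          using H(2) reversible(1) step[of "opponent p" H'] by auto
        then show ?thesis
          using less.hyps[of G H'' X p] size_option[OF H(1)] size_option[OF reversible(1)]
            reversible(2) bin(1) binary_option[OF bin_H' reversible(1)] dicot
          by auto
      qed
    qed
  qed
qed

theorem theorem3p24:
  fixes G H :: game
  assumes "binary G" and "binary H"
  shows "misere_ge binary_dicot_games G H \<longleftrightarrow> misere_ge dicot_games G H"
proof
  assume "misere_ge binary_dicot_games G H"
  then have pref: "prefers Left binary_dicot_games G H"
    by (simp add: misere_ge_iff_prefers)
  \<comment> \<open>This exchanged form supplies the half of the outcome order in which Right
    starts.\<close>
  then have "prefers (opponent Left) binary_dicot_games H G"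
    by (simp only: prefers_opponent)
  with pref show "misere_ge dicot_games G H"
    using prefers_binary_dicot_wins_first[OF _ assms] prefers_binary_dicot_wins_first[OF _ assms(2,1)]
    unfolding misere_ge_iff_prefers prefers_def[of _ dicot_games]
    by (simp add: dicot_games_def)
next
  assume "misere_ge dicot_games G H"
  then show "misere_ge binary_dicot_games G H"
    unfolding misere_ge_def binary_dicot_games_def dicot_games_def by blast
qed

end
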